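(* Let $m$ be a squarefree positive integer, let $\mathcal O$ be an order in the ring of integers $\mathcal O_{-m}$ of the imaginary quadratic field $\mathbb Q(i\sqrt m)$, and let $\mathcal I$ be a non-zero ideal of $\mathcal O$. For every $x\in\mathbb C-\mathbb Q(i\sqrt m)$, let $$c(x)=\liminf_{(p,q)\in\mathcal O\times\mathcal I,\ \langle p,q\rangle=\mathcal O,\ |q|\to\infty}|q|^2\left|x-\frac pq\right|,$$ and let $\mathrm{Sp}_{\mathrm{Lag}}$ be the set of real numbers of the form $c(x)$ for some $x\in\mathbb C-\mathbb Q(i\sqrt m)$. Then $\mathrm{Sp}_{\mathrm{Lag}}$ contains the interval $[0,0.033]$.
   Context: An order in $\mathbb Q(i\sqrt m)$ is a unitary subring of $\mathcal O_{-m}$ which is a free $\mathbb Z$-module of rank $2$. $\langle p,q\rangle$ denotes the ideal of $\mathcal O$ generated by $p$ and $q$. *)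

theory Defs
  imports Complex_Main "HOL-Computational_Algebra.Squarefree" "HOL-Library.Liminf_Limsup"
    "HOL-Library.Extended_Real"
begin

text \<open>Generator of the ring of integers of Q(i sqrt m), m squarefree positive:
  -m = 1 mod 4 (i.e. m = 3 mod 4) gives (1 + i sqrt m)/2, otherwise i sqrt m.\<close>
definition qomega :: "nat \<Rightarrow> complex" where
  "qomega m = (if m mod 4 = 3 then (1 + \<i> * complex_of_real (sqrt (real m))) / 2
               else \<i> * complex_of_real (sqrt (real m)))"

definition ring_of_integers_imq :: "nat \<Rightarrow> complex set" where
  "ring_of_integers_imq m = {of_int a + of_int b * qomega m | a b. True}"

definition imag_quad_field :: "nat \<Rightarrow> complex set" where
  "imag_quad_field m =
     {of_real (of_rat a) + of_real (of_rat b) * \<i> * complex_of_real (sqrt (real m)) | a b. True}"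

definition is_order :: "nat \<Rightarrow> complex set \<Rightarrow> bool" where
  "is_order m R \<longleftrightarrow> R \<subseteq> ring_of_integers_imq m \<and> 1 \<in> R \<and>
     (\<forall>x\<in>R. \<forall>y\<in>R. x + y \<in> R \<and> - x \<in> R \<and> x * y \<in> R) \<and>
     (\<exists>u v. (\<forall>a b::int. of_int a * u + of_int b * v = 0 \<longrightarrow> a = 0 \<and> b = 0) \<and>
            R = {of_int a * u + of_int b * v | a b::int. True})"

definition is_ideal_of :: "complex set \<Rightarrow> complex set \<Rightarrow> bool" where
  "is_ideal_of R I \<longleftrightarrow> I \<subseteq> R \<and> 0 \<in> I \<and>
     (\<forall>x\<in>I. \<forall>y\<in>I. x + y \<in> I) \<and> (\<forall>x\<in>I. - x \<in> I) \<and>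
     (\<forall>a\<in>R. \<forall>x\<in>I. a * x \<in> I)"

definition gen_ideal2 :: "complex set \<Rightarrow> complex \<Rightarrow> complex \<Rightarrow> complex set" where
  "gen_ideal2 R p q = {a * p + b * q | a b. a \<in> R \<and> b \<in> R}"

definition admissible_pairs :: "complex set \<Rightarrow> complex set \<Rightarrow> (complex \<times> complex) set" where
  "admissible_pairs R I = {(p, q). p \<in> R \<and> q \<in> I \<and> gen_ideal2 R p q = R}"

definition lagrange_c :: "complex set \<Rightarrow> complex set \<Rightarrow> complex \<Rightarrow> ereal" where
  "lagrange_c R I x =
     Liminf (inf (filtercomap (\<lambda>(p, q). cmod q) at_top) (principal (admissible_pairs R I)))
            (\<lambda>(p, q). ereal ((cmod q)^2 * cmod (x - p / q)))"

definition lagrange_spectrum :: "nat \<Rightarrow> complex set \<Rightarrow> complex set \<Rightarrow> real set" where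
  "lagrange_spectrum m R I =
     {r. \<exists>x. x \<notin> imag_quad_field m \<and> lagrange_c R I x = ereal r}"

end

theory Submission
  imports Defs "HOL-Analysis.Elementary_Metric_Spaces"
begin

text \<open>
  Distinct admissible fractions satisfy \<open>|p/q - p'/q'| \<ge> 1/|q q'|\<close>, because non-zero elements of
  \<open>R\<close> have modulus at least 1, and they are dense in the plane; nothing else about them is needed to
  find \<open>x\<close>. Call a fraction clear if the disc of radius \<open>0.034/|q|\<^sup>2\<close> around it misses the disc of
  radius \<open>r/|q'|\<^sup>2\<close> around every other fraction with \<open>|q'| \<le> |q|\<close>.

  Let \<open>p/q\<close> be clear and \<open>s > r\<close> be close to \<open>r\<close>. On the circle of radius \<open>s/|q|\<^sup>2\<close> around \<open>p/q\<close> a Cantor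
  type construction yields points that avoid, up to any given height, the discs of radius
  \<open>0.034/|q'|\<^sup>2\<close> around the fractions with \<open>|q'| > |q|\<close>. Starting from a fraction very close to such
  a point and passing to larger and larger discs as long as the current fraction is covered, one moves
  only by about \<open>r/|q'|\<^sup>2\<close>, where \<open>q'\<close> is the last denominator; hence one ends at a fraction of large
  height, which is clear and still almost on the circle. Iterating this with \<open>s\<close> decreasing to \<open>r\<close>
  gives clear fractions converging to a point \<open>x\<close> with approximation constant \<open>r\<close>.
\<close>

section \<open>Separated dense families of weighted points\<close>

lemma norm_cis_diff: "cmod (cis a - cis b) = 2 * \<bar>sin ((a - b) / 2)\<bar>"
proof -
  have "(cmod (cis a - cis b))\<^sup>2 = (cos a - cos b)\<^sup>2 + (sin a - sin b)\<^sup>2"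
    by (simp add: cmod_power2)
  also have "\<dots> = 2 - 2 * (cos a * cos b + sin a * sin b)"
    using sin_cos_squared_add[of a] sin_cos_squared_add[of b]
    by (simp add: power2_eq_square algebra_simps)
  also have "\<dots> = 2 - 2 * cos (a - b)"
    by (simp add: cos_diff)
  also have "\<dots> = 2 - 2 * cos (2 * ((a - b) / 2))"
    by (simp only: times_divide_eq_right nonzero_mult_div_cancel_left[OF zero_neq_numeral[symmetric]])
  also have "\<dots> = (2 * \<bar>sin ((a - b) / 2)\<bar>)\<^sup>2"
    unfolding cos_double_sin by (simp add: power_mult_distrib)
  finally show ?thesis
    by (subst (asm) power2_eq_iff_nonneg) auto
qed

lemma norm_cis_diff_le: "cmod (cis a - cis b) \<le> \<bar>a - b\<bar>"
  using abs_sin_x_le_abs_x[of "(a - b) / 2"] by (simp add: norm_cis_diff)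

lemma norm_cis_diff_ge:
  assumes "\<bar>a - b\<bar> \<le> 1/10"
  shows "9/10 * \<bar>a - b\<bar> \<le> cmod (cis a - cis b)"
proof -
  define t where "t = \<bar>a - b\<bar> / 2"
  have t: "0 \<le> t" "t \<le> 1/20" using assms by (auto simp: t_def)
  have "\<bar>sin ((a - b) / 2)\<bar> = \<bar>sin t\<bar>"
  proof (cases "a < b")
    case True
    then have "t = - ((a - b) / 2)" unfolding t_def by linarith
    then show ?thesis by (simp only: sin_minus abs_minus_cancel)
  qed (simp add: t_def)
  moreover have "9/10 * t \<le> sin t"
  proof (cases "t = 0")
    case False
    then obtain z where z: "0 < z" "z < t" "sin t - sin 0 = (t - 0) * cos z"
      using MVT2[of 0 t sin cos] t by (auto intro: DERIV_sin)
    have "cos z = 1 - 2 * (sin (z/2))\<^sup>2"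
      using cos_double_sin[of "z/2"] by simp
    moreover have "(sin (z/2))\<^sup>2 \<le> (z/2)\<^sup>2"
      using abs_sin_x_le_abs_x[of "z/2"] by (rule abs_le_square_iff[THEN iffD1])
    moreover have "(z/2)\<^sup>2 \<le> (1/40)\<^sup>2"
      using z t by (intro power_mono) auto
    ultimately have "9/10 \<le> cos z" by (simp add: power2_eq_square)
    then show ?thesis using z t by (simp add: mult.commute mult_left_mono)
  qed simp
  ultimately have "9/10 * t \<le> \<bar>sin ((a - b) / 2)\<bar>" by linarith
  then show ?thesis by (simp add: norm_cis_diff t_def)
qed

text \<open>An element \<open>(z, h)\<close> stands for a fraction \<open>z = p / q\<close> with \<open>h = |q|\<close>.\<close>

locale separated_points =
  fixes S :: "(complex \<times> real) set"
  assumes height_ge_1: "(z, h) \<in> S \<Longrightarrow> 1 \<le> h"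
    and separated: "(z, h) \<in> S \<Longrightarrow> (z', h') \<in> S \<Longrightarrow> (z, h) \<noteq> (z', h') \<Longrightarrow> 1 / (h * h') \<le> dist z z'"
    and dense: "0 < e \<Longrightarrow> \<exists>(z, h)\<in>S. H < h \<and> dist x z < e"
begin

section \<open>Clear points and the descent to them\<close>

text \<open>With \<open>h0 = 0\<close> this is clearness against all other points of height at most
  \<open>h\<close>, since heights are at least 1. A positive \<open>h0\<close> ignores the low
  points, so that a descent can be kept above height \<open>h0\<close>.\<close>

definition clear_above :: "real \<Rightarrow> real \<Rightarrow> complex \<Rightarrow> real \<Rightarrow> bool" where
  "clear_above r h0 z h \<longleftrightarrow> (z, h) \<in> S \<and>
     (\<forall>(z', h')\<in>S. h0 < h' \<and> h' \<le> h \<and> (z', h') \<noteq> (z, h) \<longrightarrow>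
        r / h'\<^sup>2 + 34/1000 / h\<^sup>2 \<le> dist z z')"

lemma clear_aboveI:
  assumes "(z, h) \<in> S"
    and "\<And>z' h'. (z', h') \<in> S \<Longrightarrow> h0 < h' \<Longrightarrow> h' \<le> h \<Longrightarrow> (z', h') \<noteq> (z, h) \<Longrightarrow>
      r / h'\<^sup>2 + 34/1000 / h\<^sup>2 \<le> dist z z'"
  shows "clear_above r h0 z h"
  using assms unfolding clear_above_def by blast

text \<open>A covering point has height at most \<open>0.04 h\<close>, so the displacements of successive steps towards
  covering points decay geometrically. The subtracted term makes the bound telescope.\<close>

lemma clear_above_exists_aux:
  assumes "r \<le> 33/1000"
  shows "(z, h) \<in> S \<Longrightarrow> h0 < h \<Longrightarrow> h \<le> 2 ^ n \<Longrightarrow>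
    \<exists>z' h'. clear_above r h0 z' h' \<and> h0 < h' \<and> dist z z' \<le> 67/2000 / h'\<^sup>2 - 67/2000 / h\<^sup>2"
proof (induction n arbitrary: z h)
  have descend: "clear_above r h0 z h \<or> (\<exists>z' h'. (z', h') \<in> S \<and> h0 < h' \<and> 2 * h' \<le> h \<and>
      dist z z' \<le> 67/2000 / h'\<^sup>2 - 67/2000 / h\<^sup>2)"
    if zh: "(z, h) \<in> S" for z h
  proof (rule disjCI)
    assume no: "\<not> (\<exists>z' h'. (z', h') \<in> S \<and> h0 < h' \<and> 2 * h' \<le> h \<and>
      dist z z' \<le> 67/2000 / h'\<^sup>2 - 67/2000 / h\<^sup>2)"
    show "clear_above r h0 z h"
    proof (rule ccontr)
      assume "\<not> clear_above r h0 z h"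
      then obtain z' h' where 1: "(z', h') \<in> S" "h0 < h'" "h' \<le> h" "(z', h') \<noteq> (z, h)"
        and 2: "dist z z' < r / h'\<^sup>2 + 34/1000 / h\<^sup>2"
        using zh unfolding clear_above_def by fastforce
      have pos: "0 < h" "0 < h'" using height_ge_1 zh 1(1) by fastforce+
      define u where "u = h' / h"
      have u: "0 < u" "u \<le> 1" using pos 1 by (auto simp: u_def)
      have h': "h' = u * h" using pos by (simp add: u_def)
      have "1 / (h * h') < r / h'\<^sup>2 + 34/1000 / h\<^sup>2"
        using separated[OF zh 1(1)] 1(4) 2 by force
      then have "1 / (h * h') * h'\<^sup>2 < (r / h'\<^sup>2 + 34/1000 / h\<^sup>2) * h'\<^sup>2"
        using pos by (intro mult_strict_right_mono) auto
      moreover have "1 / (h * h') * h'\<^sup>2 = u"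
        using pos u unfolding h' by (simp add: power2_eq_square)
      moreover have "(r / h'\<^sup>2 + 34/1000 / h\<^sup>2) * h'\<^sup>2 = r + 34/1000 * (u * u)"
        using pos u unfolding h' by (simp add: distrib_right power2_eq_square)
      \<comment> \<open>With \<open>u * u \<le> u\<close> this gives
        \<open>u < 0.033 / 0.966\<close>, so a covering point is much lower than the point it
        covers.\<close>
      ultimately have "u < r + 34/1000 * (u * u)" by simp
      moreover have "u * u \<le> u" using u by (simp add: mult_left_le)
      ultimately have u2: "u \<le> 4/100" using assms by linarith
      have "u * u \<le> 4/100 * (4/100)" using u u2 by (intro mult_mono) auto
      \<comment> \<open>The constant 67/2000 lies halfway between 33/1000 and 34/1000. Its excess
        over \<open>r\<close> is at least 1/2000, which absorbs
        \<open>(34/1000 + 67/2000) * (u * u)\<close>, at most 0.000108 because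
        \<open>u \<le> 4/100\<close>.\<close>
      then have "r + 34/1000 * (u * u) \<le> 67/2000 - 67/2000 * (u * u)"
        using assms by linarith
      then have "(r + 34/1000 * (u * u)) / h'\<^sup>2 \<le> (67/2000 - 67/2000 * (u * u)) / h'\<^sup>2"
        by (intro divide_right_mono) auto
      then have "r / h'\<^sup>2 + 34/1000 / h\<^sup>2 \<le> 67/2000 / h'\<^sup>2 - 67/2000 / h\<^sup>2"
        using pos u unfolding h' by (simp add: add_divide_distrib diff_divide_distrib power2_eq_square)
      moreover have "2 * h' \<le> h" using u2 pos u unfolding h' by simp
      ultimately show False using no 1 2 by force
    qed
  qed
  {
    case 0
    \<comment> \<open>A descent step would end at height at most 1/2, below the least possible
      height 1.\<close>
    have "h \<le> 1" using 0 by simp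
    then show ?case using descend[of z h] 0 height_ge_1
      by (smt (verit) dist_self)
  next
    case (Suc n)
    show ?case
    proof (cases "clear_above r h0 z h")
      case True
      then show ?thesis using Suc by (intro exI[of _ z] exI[of _ h]) auto
    next
      case False
      then obtain z1 h1 where 1: "(z1, h1) \<in> S" "h0 < h1" "2 * h1 \<le> h"
        and d1: "dist z z1 \<le> 67/2000 / h1\<^sup>2 - 67/2000 / h\<^sup>2"
        using descend Suc.prems by blast
      then obtain z' h' where "clear_above r h0 z' h'" "h0 < h'"
        "dist z1 z' \<le> 67/2000 / h'\<^sup>2 - 67/2000 / h1\<^sup>2"
        using Suc.IH[of z1 h1] Suc.prems by auto
      then show ?thesis using d1 dist_triangle[of z z' z1] by (intro exI[of _ z'] exI[of _ h']) auto
    qed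
  }
qed

lemma clear_above_exists:
  assumes "r \<le> 33/1000" "(z, h) \<in> S" "h0 < h"
  obtains z' h' where "clear_above r h0 z' h'" "h0 < h'" "dist z z' \<le> 67/2000 / h'\<^sup>2"
proof -
  obtain n where "h < 2 ^ n" using real_arch_pow[of 2 h] by auto
  then obtain z' h' where "clear_above r h0 z' h'" "h0 < h'"
    "dist z z' \<le> 67/2000 / h'\<^sup>2 - 67/2000 / h\<^sup>2"
    using clear_above_exists_aux[OF assms, of n] by auto
  moreover have "0 \<le> 67/2000 / h\<^sup>2" by simp
  ultimately show ?thesis using that by fastforce
qed

section \<open>Arcs that avoid the discs of higher points\<close>

text \<open>Two points whose heights are within a factor 2 of each other are too far apart to threaten
  both the first and the last quarter of the same arc, and one point threatens too short
  a part of it.\<close>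

lemma free_arc:
  fixes z0 h0 s
  defines "f \<equiv> \<lambda>t. z0 + of_real (s / h0\<^sup>2) * cis t"
  assumes z0: "(z0, h0) \<in> S" and s: "0 < s" "s \<le> 34/1000"
  shows "\<exists>a\<ge>0. a + 72/100 * s / 4 ^ n \<le> 1/10 \<and> (\<forall>t\<in>{a..a + 72/100 * s / 4 ^ n}. \<forall>(z, h)\<in>S.
     h0 < h \<and> h \<le> h0 / (2 * s) * 2 ^ n \<longrightarrow> 34/1000 / h\<^sup>2 \<le> dist (f t) z)"
proof (induction n)
  case 0
  have "34/1000 / h\<^sup>2 \<le> dist (f t) z" if zh: "(z, h) \<in> S" "h0 < h" "h \<le> h0 / (2 * s)" for t z h
  proof -
    have pos: "0 < h" "0 < h0" using height_ge_1 zh(1) z0 by fastforce+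
    define w where "w = h / h0"
    have w: "1 < w" "s * w \<le> 1/2" using pos zh s by (auto simp: w_def field_simps)
    have h: "h = w * h0" using pos by (simp add: w_def)
    have "1 / (h0 * h) \<le> dist z0 z" using separated[OF z0 zh(1)] zh(2) by auto
    moreover have "dist z0 (f t) = s / h0\<^sup>2"
      using s by (simp add: f_def dist_norm norm_mult norm_divide norm_power)
    \<comment> \<open>Multiplied by \<open>h\<^sup>2\<close> this reads
      \<open>34/1000 + s * w\<^sup>2 \<le> w\<close>. The initial height bound
      \<open>h0 / (2 * s)\<close> is chosen to give \<open>s * w \<le> 1/2\<close>, and
      \<open>w > 1\<close> covers the remaining 34/1000.\<close>
    moreover have "34/1000 / h\<^sup>2 + s / h0\<^sup>2 \<le> 1 / (h0 * h)"
    proof -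
      have "(s * w) * w \<le> 1/2 * w" using w by (intro mult_right_mono) auto
      then have "34/1000 + s * w\<^sup>2 \<le> w" using w unfolding power2_eq_square mult.assoc by linarith
      then have "(34/1000 + s * w\<^sup>2) / h\<^sup>2 \<le> w / h\<^sup>2" by (intro divide_right_mono) auto
      then show ?thesis using pos w unfolding h
        by (simp add: add_divide_distrib power2_eq_square)
    qed
    ultimately show ?thesis using dist_triangle[of z0 z "f t"] by linarith
  qed
  then show ?case using s by (intro exI[of _ 0]) auto
next
  case (Suc n)
  define W where "W = h0 / (2 * s) * 2 ^ n"
  define L where "L = 72/100 * s / 4 ^ n"
  have h0: "1 \<le> h0" using height_ge_1 z0 by blast
  have W: "0 < W" and L: "0 < L" using h0 s by (auto simp: W_def L_def)
  define V where "V = 1 / W\<^sup>2"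
  have V: "0 < V" using W by (simp add: V_def)
  \<comment> \<open>The factor 72/100 makes the arc 0.18 / \<open>W\<^sup>2\<close> long. A single
    point bad for both outer quarters would need a chord of at least 0.9 * 0.09 = 0.081 (times
    \<open>V\<close>) to be shorter than 2 * 0.034 = 0.068. Two distinct points would be closer than
    0.18 + 0.068 = 0.248, but separation at heights up to \<open>2 * W\<close> forces 0.25.\<close>
  have LW: "s / h0\<^sup>2 * L = 18/100 * V"
  proof -
    have "(2 ^ n)\<^sup>2 = (4::real) ^ n" by (simp add: power2_eq_square flip: power_mult_distrib)
    then show ?thesis using h0 s by (simp add: V_def W_def L_def field_simps power_mult_distrib power2_eq_square)
  qed
  obtain a where a: "0 \<le> a" "a + L \<le> 1/10"
    and free: "\<And>t z h. t \<in> {a..a + L} \<Longrightarrow> (z, h) \<in> S \<Longrightarrow> h0 < h \<Longrightarrow> h \<le> W \<Longrightarrow> 34/1000 / h\<^sup>2 \<le> dist (f t) z"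
    using Suc unfolding W_def L_def by fastforce
  define bad where "bad t z h \<longleftrightarrow> (z, h) \<in> S \<and> W < h \<and> h \<le> 2 * W \<and> dist (f t) z < 34/1000 / h\<^sup>2" for t z h
  have dist_f: "dist (f t) (f t') = s / h0\<^sup>2 * cmod (cis t - cis t')" for t t'
  proof -
    have "f t - f t' = of_real (s / h0\<^sup>2) * (cis t - cis t')"
      unfolding f_def by (simp only: add_diff_cancel_left right_diff_distrib)
    then show ?thesis using s by (simp add: dist_norm norm_mult norm_divide norm_power)
  qed
  have bad_lt: "dist (f t) z < 34/1000 * V" if "bad t z h" for t z h
  proof -
    have "W\<^sup>2 \<le> h\<^sup>2" using that W by (intro power_mono) (auto simp: bad_def)
    then have "34/1000 / h\<^sup>2 \<le> 34/1000 / W\<^sup>2"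
      using W that by (intro divide_left_mono mult_pos_pos) (auto simp: bad_def)
    then show ?thesis using that by (auto simp: bad_def V_def)
  qed
  have not_both: False
    if t: "t \<in> {a..a + L/4}" "t' \<in> {a + 3*L/4..a + L}" and b: "bad t z h" "bad t' z' h'" for t t' z z' h h'
  proof (cases "(z, h) = (z', h')")
    case True
    have tt: "L/2 \<le> \<bar>t - t'\<bar>" "\<bar>t - t'\<bar> \<le> 1/10" using t a by auto
    then have "9/10 * (L/2) \<le> cmod (cis t - cis t')"
      using order_trans[OF mult_left_mono[OF tt(1), of "9/10"] norm_cis_diff_ge[OF tt(2)]] by simp
    then have "s / h0\<^sup>2 * (9/10 * (L/2)) \<le> dist (f t) (f t')"
      unfolding dist_f using s by (intro mult_left_mono) auto
    moreover have "dist (f t) (f t') < 34/1000 * V + 34/1000 * V"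
      using bad_lt[OF b(1)] bad_lt[OF b(2)] True dist_triangle2[of "f t" "f t'" z] by auto
    ultimately have "9/20 * (18/100 * V) < 68/1000 * V"
      using LW by (simp add: algebra_simps)
    then show False using V by simp
  next
    case False
    have "\<bar>t - t'\<bar> \<le> L" using t by auto
    then have "cmod (cis t - cis t') \<le> L" using norm_cis_diff_le[of t t'] by linarith
    then have "dist (f t) (f t') \<le> 18/100 * V"
      unfolding dist_f LW[symmetric] using s by (intro mult_left_mono) auto
    then have "dist z z' < 248/1000 * V"
      using bad_lt[OF b(1)] bad_lt[OF b(2)] dist_triangle[of z z' "f t"]
        dist_triangle[of "f t" z' "f t'"] dist_commute[of z "f t"] by simp
    moreover have "1 / (h * h') \<le> dist z z'"
      using separated False b by (auto simp: bad_def)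
    moreover have "1 / (2 * W * (2 * W)) \<le> 1 / (h * h')"
      using b W by (intro divide_left_mono mult_mono mult_pos_pos) (auto simp: bad_def)
    moreover have "1 / (2 * W * (2 * W)) = V / 4" by (simp add: V_def power2_eq_square)
    ultimately show False using V by linarith
  qed
  obtain a' where a': "a \<le> a'" "a' + L/4 \<le> a + L"
    and nobad: "\<And>t z h. t \<in> {a'..a' + L/4} \<Longrightarrow> \<not> bad t z h"
  proof (cases "\<exists>t\<in>{a..a + L/4}. \<exists>z h. bad t z h")
    case True
    then show ?thesis using not_both that[of "a + 3*L/4"] L by fastforce
  next
    case False
    then show ?thesis using that[of a] L by auto
  qed
  have "34/1000 / h\<^sup>2 \<le> dist (f t) z"
    if "t \<in> {a'..a' + L/4}" "(z, h) \<in> S" "h0 < h" "h \<le> 2 * W" for t z h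
    using free[of t z h] nobad[of t z h] that a' by (cases "h \<le> W") (auto simp: bad_def)
  then show ?case using a a'
    by (intro exI[of _ a']) (auto simp: L_def W_def mult_ac)
qed

section \<open>From one clear point to the next\<close>

text \<open>The new point is found by a descent that ignores heights up to \<open>h0\<close>. The
  ignored points do no harm: \<open>z0\<close> is about \<open>s / h0\<^sup>2\<close> away with
  \<open>s > r\<close>, and the others are kept off by the clearness of \<open>z0\<close>, whose
  disc of radius \<open>34/1000 / h0\<^sup>2\<close> contains the circle with room to spare.\<close>

lemma next_clear:
  assumes z0: "clear_above r 0 z0 h0" and r: "0 \<le> r" "r < s" "s < 34/1000" "r \<le> 33/1000" and d: "0 < d"
  obtains z1 h1 where "clear_above r 0 z1 h1" "H < h1"
    "dist z0 z1 < (s + d) / h0\<^sup>2" "(s - d) / h0\<^sup>2 < dist z0 z1"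
proof -
  have S0: "(z0, h0) \<in> S" using z0 by (simp add: clear_above_def)
  have h0: "1 \<le> h0" using height_ge_1 S0 by blast
  \<comment> \<open>The three entries are the slack towards \<open>z0\<close>, the slack towards the
    other points of height at most \<open>h0\<close>, and the requested precision.\<close>
  define e where "e = Min {s - r, 34/1000 - s, d} / h0\<^sup>2"
  have e: "0 < e" "e \<le> (s - r) / h0\<^sup>2" "e \<le> (34/1000 - s) / h0\<^sup>2" "e \<le> d / h0\<^sup>2"
    unfolding e_def using r d h0 by (auto intro!: divide_right_mono)
  obtain n where n: "max (max H (h0 + 1)) (2 / e) / (h0 / (2 * s)) < 2 ^ n"
    using real_arch_pow[of 2] by auto
  define T where "T = h0 / (2 * s) * 2 ^ n"
  have "max (max H (h0 + 1)) (2 / e) < T"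
    using n h0 r by (subst (asm) pos_divide_less_eq) (auto simp: T_def mult_ac)
  then have T: "H < T" "h0 < T" "2 / e < T" by auto
  have T1: "1 < T" using T h0 by simp
  have Te: "2 / T\<^sup>2 < e"
  proof -
    have "2 / T < e" using T e T1 by (simp add: field_simps)
    moreover have "2 / T\<^sup>2 \<le> 2 / T" using T1 by (intro divide_left_mono) (auto simp: power2_eq_square)
    ultimately show ?thesis by simp
  qed
  obtain a where a: "\<forall>t\<in>{a..a + 72/100 * s / 4 ^ n}. \<forall>(z, h)\<in>S.
     h0 < h \<and> h \<le> T \<longrightarrow> 34/1000 / h\<^sup>2 \<le> dist (z0 + of_real (s / h0\<^sup>2) * cis t) z"
    using free_arc[OF S0, of s n] r unfolding T_def by auto
  define x where "x = z0 + of_real (s / h0\<^sup>2) * cis a"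
  have x: "34/1000 / h\<^sup>2 \<le> dist x z" if "(z, h) \<in> S" "h0 < h" "h \<le> T" for z h
  proof -
    have "a \<in> {a..a + 72/100 * s / 4 ^ n}" using r by simp
    then show ?thesis using a that unfolding x_def by fast
  qed
  have xz0: "dist z0 x = s / h0\<^sup>2"
    using r by (simp add: x_def dist_norm norm_mult norm_divide norm_power)
  have "0 < 1/2000 / T\<^sup>2" using T1 by simp
  then obtain z h where zh: "(z, h) \<in> S" "h0 < h" "dist x z < 1/2000 / T\<^sup>2"
    using dense[of "1/2000 / T\<^sup>2" h0 x] by auto
  obtain z1 h1 where 1: "clear_above r h0 z1 h1" "h0 < h1" "dist z z1 \<le> 67/2000 / h1\<^sup>2"
    using clear_above_exists[OF r(4) zh(1,2)] by blast
  have xz1: "dist x z1 < 1/2000 / T\<^sup>2 + 67/2000 / h1\<^sup>2"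
    using zh 1 dist_triangle[of x z1 z] by linarith
  have S1: "(z1, h1) \<in> S" using 1 by (simp add: clear_above_def)
  \<comment> \<open>The split 34/1000 = 1/2000 + 67/2000 is used here: a point \<open>z1\<close> of
    height at most \<open>T\<close> would lie closer to \<open>x\<close> than
    \<open>34/1000 / h1\<^sup>2\<close>, although \<open>x\<close> is on the free arc.\<close>
  have h1: "T < h1"
  proof (rule ccontr)
    assume "\<not> T < h1"
    then have le: "h1 \<le> T" by simp
    have "h1\<^sup>2 \<le> T\<^sup>2" using le h0 1 by (intro power_mono) auto
    then have "1/2000 / T\<^sup>2 \<le> 1/2000 / h1\<^sup>2" using 1 h0 T1 by (intro divide_left_mono) auto
    then show False using x[OF S1 1(2) le] xz1 by simp
  qed
  have "T\<^sup>2 \<le> h1\<^sup>2" using h1 T1 by (intro power_mono) auto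
  then have hT: "1 / h1\<^sup>2 \<le> 1 / T\<^sup>2" using T1 h1 by (intro divide_left_mono mult_pos_pos) auto
  have xz1': "dist x z1 + 34/1000 / h1\<^sup>2 < e"
  proof -
    have "dist x z1 + 34/1000 * (1 / h1\<^sup>2) < 1/2000 * (1 / T\<^sup>2) + 135/2000 * (1 / h1\<^sup>2)" using xz1 by simp
    also have "\<dots> \<le> 2 * (1 / T\<^sup>2)" using hT zero_le_divide_1_iff[of "T\<^sup>2"] zero_le_power2[of T] by linarith
    finally show ?thesis using Te by simp
  qed
  have h1e: "0 \<le> 34/1000 / h1\<^sup>2" by simp
  show ?thesis
  proof
    show "H < h1" using h1 T by simp
    show "dist z0 z1 < (s + d) / h0\<^sup>2"
      using xz0 xz1' h1e e(4) dist_triangle[of z0 z1 x] unfolding add_divide_distrib by linarith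
    show "(s - d) / h0\<^sup>2 < dist z0 z1"
      using xz0 xz1' h1e e(4) dist_triangle[of z0 x z1] dist_commute[of x z1] unfolding diff_divide_distrib by linarith
    show "clear_above r 0 z1 h1"
    proof (rule clear_aboveI[OF S1])
      fix z' h' assume z': "(z', h') \<in> S" "0 < h'" "h' \<le> h1" "(z', h') \<noteq> (z1, h1)"
      \<comment> \<open>The cases use, in turn, the clearness of \<open>z1\<close> above
        \<open>h0\<close>, the inequality \<open>s > r\<close>, and the clearness of
        \<open>z0\<close> with \<open>s < 34/1000\<close>.\<close>
      consider "h0 < h'" | "(z', h') = (z0, h0)" | "h' \<le> h0" "(z', h') \<noteq> (z0, h0)" by fastforce
      then show "r / h'\<^sup>2 + 34/1000 / h1\<^sup>2 \<le> dist z1 z'"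
      proof cases
        case 1
        then show ?thesis using \<open>clear_above r h0 z1 h1\<close> z' by (auto simp: clear_above_def)
      next
        case 2
        then show ?thesis
          using xz0 xz1' e(2) dist_triangle[of z0 x z1] by (simp add: diff_divide_distrib dist_commute)
      next
        case 3
        then have "r / h'\<^sup>2 + 34/1000 / h0\<^sup>2 \<le> dist z0 z'"
          using z0 z' by (auto simp: clear_above_def)
        then show ?thesis
          using xz0 xz1' e(3) dist_triangle[of z0 z' x] dist_triangle[of x z' z1]
          by (simp add: diff_divide_distrib dist_commute)
      qed
    qed
  qed
qed

section \<open>The limit of a sequence of clear points\<close>

text \<open>The point \<open>x\<close> is the common point of nested discs around clear points
  \<open>Z k\<close> of radius \<open>c k / (h k)\<^sup>2\<close>, with \<open>c k\<close> tending
  to \<open>r\<close>. Clearness passes to the limit and gives the lower bound; the radii give the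
  upper one.\<close>

theorem exists_approximation_constant:
  assumes r: "0 \<le> r" "r \<le> 33/1000"
  obtains x where "\<And>z h. (z, h) \<in> S \<Longrightarrow> r \<le> h\<^sup>2 * dist x z"
    and "\<And>e H. 0 < e \<Longrightarrow> \<exists>(z, h)\<in>S. H < h \<and> x \<noteq> z \<and> h\<^sup>2 * dist x z < r + e"
proof -
  \<comment> \<open>The summand 1/1000 is the largest that keeps \<open>c k\<close> within 34/1000
    when \<open>r\<close> is 33/1000.\<close>
  define c where "c k = r + 1/1000 / real (Suc k)" for k
  have c: "r < c k" "c k \<le> 34/1000" for k
  proof -
    have "1/1000 / real (Suc k) \<le> 1/1000 / 1" by (intro divide_left_mono) auto
    moreover have "0 < 1/1000 / real (Suc k)" by simp
    ultimately show "r < c k" "c k \<le> 34/1000" using r unfolding c_def by linarith+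
  qed
  obtain zi hi where "(zi, hi) \<in> S" "0 < hi" using dense[of 1 0 0] by auto
  then obtain z00 h00 where init: "clear_above r 0 z00 h00"
    using clear_above_exists[OF r(2)] by blast
  \<comment> \<open>Since \<open>c (Suc k) \<le> 1\<close>, the term
    \<open>1 / (snd w')\<^sup>2\<close> bounds the radius of the next disc. The third condition thus
    nests the discs, and the last one keeps \<open>fst w\<close> outside the next disc, so that the
    limit differs from every centre.\<close>
  define P where "P k w w' \<longleftrightarrow> real k < snd w' \<and> snd w < snd w' \<and>
     dist (fst w) (fst w') + 1 / (snd w')\<^sup>2 \<le> c k / (snd w)\<^sup>2 \<and> 1 / (snd w')\<^sup>2 < dist (fst w) (fst w')"
    for k :: nat and w w' :: "complex \<times> real"
  have step: "\<exists>w'. clear_above r 0 (fst w') (snd w') \<and> P k w w'"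
    if w: "clear_above r 0 (fst w) (snd w)" for k w
  proof -
    obtain z h where wzh: "w = (z, h)" by force
    have zh: "clear_above r 0 z h" using w wzh by simp
    have h: "1 \<le> h" using height_ge_1 zh by (auto simp: clear_above_def)
    \<comment> \<open>Aiming at radius \<open>r + 2 * d\<close> with error \<open>d\<close> leaves
      one \<open>d\<close> above, for the term \<open>1 / h'\<^sup>2\<close> in the nesting, and at
      least one \<open>d\<close> below, for the lower bound on the distance. The height bound
      \<open>h\<^sup>2 / d\<close> makes that term at most \<open>d / h\<^sup>2\<close>.\<close>
    define d where "d = (c k - r) / 4"
    have d: "0 < d" using c[of k] by (simp add: d_def)
    have s: "r < r + 2 * d" using d by simp
    have ck: "c k = r + 4 * d" by (simp add: d_def field_simps)
    then have s': "r + 2 * d < 34/1000" using d c(2)[of k] by simp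
    obtain z' h' where z': "clear_above r 0 z' h'" "max (max (real k) h) (h\<^sup>2 / d) < h'"
      "dist z z' < (r + 2 * d + d) / h\<^sup>2" "(r + 2 * d - d) / h\<^sup>2 < dist z z'"
      using next_clear[OF zh r(1) s s' r(2) d] by blast
    have "1 / h'\<^sup>2 \<le> d / h\<^sup>2"
    proof -
      have "h\<^sup>2 / d \<le> h' * 1" using z' by simp
      also have "\<dots> \<le> h' * h'" using z' h by (intro mult_left_mono) auto
      finally have "h\<^sup>2 \<le> d * h'\<^sup>2" using d by (simp add: field_simps power2_eq_square)
      then show ?thesis using h z' by (simp add: field_simps)
    qed
    moreover have "(r + 2 * d + d) / h\<^sup>2 + d / h\<^sup>2 = c k / h\<^sup>2"
      by (simp add: ck flip: add_divide_distrib)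
    moreover have "(r + 2 * d - d) / h\<^sup>2 = r / h\<^sup>2 + d / h\<^sup>2" by (simp flip: add_divide_distrib)
    moreover have "0 \<le> r / h\<^sup>2" using r by simp
    ultimately have "P k (z, h) (z', h')"
      using z' unfolding P_def fst_conv snd_conv by auto
    then show ?thesis using z' wzh by (intro exI[of _ "(z', h')"]) auto
  qed
  obtain w where w: "\<And>k. clear_above r 0 (fst (w k)) (snd (w k))" "\<And>k. P k (w k) (w (Suc k))"
    using dependent_nat_choice[of "\<lambda>_ w. clear_above r 0 (fst w) (snd w)" P] step init
    by (metis fst_conv snd_conv)
  define Z h where "Z k = fst (w k)" and "h k = snd (w k)" for k
  have clear: "clear_above r 0 (Z k) (h k)" for k using w by (simp add: Z_def h_def)
  then have inS: "(Z k, h k) \<in> S" for k by (simp add: clear_above_def)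
  have h1: "1 \<le> h k" for k using height_ge_1 inS by blast
  have hk: "real k < h (Suc k)" and
    hSuc: "h k < h (Suc k)" and
    nest: "dist (Z k) (Z (Suc k)) + 1 / (h (Suc k))\<^sup>2 \<le> c k / (h k)\<^sup>2" and
    apart: "1 / (h (Suc k))\<^sup>2 < dist (Z k) (Z (Suc k))" for k
    using w(2)[of k] by (auto simp: P_def Z_def h_def)
  define D where "D k = cball (Z k) (c k / (h k)\<^sup>2)" for k
  have c_le: "c k / (h k)\<^sup>2 \<le> 1 / (h k)\<^sup>2" for k
    using c(2)[of k] by (intro divide_right_mono) auto
  have D_Suc: "D (Suc k) \<subseteq> D k" for k
  proof
    fix y assume "y \<in> D (Suc k)"
    then show "y \<in> D k"
      using nest[of k] c_le[of "Suc k"] dist_triangle[of "Z k" y "Z (Suc k)"] by (simp add: D_def)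
  qed
  have h_lim: "filterlim h at_top sequentially"
  proof -
    have "filterlim (\<lambda>k. h (Suc k)) at_top sequentially"
      by (rule filterlim_at_top_mono[OF filterlim_real_sequentially])
        (use hk in \<open>auto intro!: always_eventually less_imp_le\<close>)
    then show ?thesis by (rule filterlim_sequentially_Suc[THEN iffD1])
  qed
  have rad_lim: "(\<lambda>k. 1 / (h k)\<^sup>2) \<longlonglongrightarrow> 0"
    by (intro real_tendsto_divide_at_top[OF tendsto_const] filterlim_pow_at_top h_lim) auto
  obtain x where x: "\<And>k. x \<in> D k"
  proof (rule decreasing_closed_nest[of D])
    show "closed (D n)" for n by (simp add: D_def)
    have "0 \<le> c n / (h n)\<^sup>2" for n using c(1)[of n] r by (intro divide_nonneg_nonneg) auto
    then show "D n \<noteq> {}" for n by (simp add: D_def not_less)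
    show "D n \<subseteq> D m" if "m \<le> n" for m n
      using lift_Suc_antimono_le[of D, OF D_Suc that] .
    show "\<exists>n. \<forall>x\<in>D n. \<forall>y\<in>D n. dist x y < e" if "0 < e" for e
    proof -
      have "\<forall>\<^sub>F k in sequentially. 1 / (h k)\<^sup>2 < e / 2"
        using rad_lim that by (intro order_tendstoD) auto
      then obtain k where "1 / (h k)\<^sup>2 < e / 2" by (auto simp: eventually_sequentially)
      then have "dist y y' < e" if "y \<in> D k" "y' \<in> D k" for y y'
        using that c_le[of k] dist_triangle3[of y y' "Z k"] unfolding D_def mem_cball by linarith
      then show ?thesis by blast
    qed
  qed (rule that)
  have xZ: "dist x (Z k) \<le> c k / (h k)\<^sup>2" for k using x[of k] by (simp add: D_def dist_commute)
  have Z_lim: "Z \<longlonglongrightarrow> x"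
  proof (rule tendsto_dist_iff[THEN iffD2], rule tendsto_sandwich[OF _ _ tendsto_const rad_lim])
    show "\<forall>\<^sub>F k in sequentially. dist (Z k) x \<le> 1 / (h k)\<^sup>2"
      using order_trans[OF xZ c_le] by (intro always_eventually allI) (simp only: dist_commute)
  qed auto
  show ?thesis
  proof
    fix z h' assume S: "(z, h') \<in> S"
    have pos: "0 < h'" using height_ge_1 S by fastforce
    have "\<forall>\<^sub>F k in sequentially. h' < h k"
      using h_lim by (simp add: filterlim_at_top_dense)
    then have "\<forall>\<^sub>F k in sequentially. r / h'\<^sup>2 \<le> dist (Z k) z"
    proof eventually_elim
      case (elim k)
      then have "r / h'\<^sup>2 + 34/1000 / (h k)\<^sup>2 \<le> dist (Z k) z"
        using clear[of k] S pos by (auto simp: clear_above_def)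
      moreover have "0 \<le> 34/1000 / (h k)\<^sup>2" by simp
      ultimately show ?case by linarith
    qed
    then have "r / h'\<^sup>2 \<le> dist x z"
      by (intro tendsto_lowerbound[OF tendsto_dist[OF Z_lim tendsto_const]]) auto
    then show "r \<le> h'\<^sup>2 * dist x z" using pos by (simp add: field_simps)
  next
    fix e H :: real assume e: "0 < e"
    have "c \<longlonglongrightarrow> r + 0"
      unfolding c_def by (intro tendsto_intros LIMSEQ_Suc lim_const_over_n)
    then have "\<forall>\<^sub>F k in sequentially. c k < r + e"
      using e by (intro order_tendstoD) auto
    moreover have "\<forall>\<^sub>F k in sequentially. H < h k"
      using h_lim by (simp add: filterlim_at_top_dense)
    ultimately have "\<forall>\<^sub>F k in sequentially. c k < r + e \<and> H < h k" by (rule eventually_conj)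
    then obtain k where k: "c k < r + e" "H < h k" by (auto simp: eventually_sequentially)
    have "x \<noteq> Z k"
      using apart[of k] xZ[of "Suc k"] c_le[of "Suc k"] by auto
    moreover have "(h k)\<^sup>2 * dist x (Z k) \<le> c k"
      using xZ[of k] h1[of k] by (simp add: pos_le_divide_eq mult.commute)
    ultimately show "\<exists>(z, h)\<in>S. H < h \<and> x \<noteq> z \<and> h\<^sup>2 * dist x z < r + e"
      using k inS[of k] by (intro bexI[of _ "(Z k, h k)"]) auto
  qed
qed

end

section \<open>Admissible fractions of an order\<close>

text \<open>The squared modulus is the field norm, an integral binary quadratic form in the
  coordinates, so a non-zero value is at least 1.\<close>

lemma ring_of_integers_imq_norm_ge_1:
  assumes "x \<in> ring_of_integers_imq m" "x \<noteq> 0"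
  shows "1 \<le> cmod x"
proof -
  obtain a b :: int where x: "x = of_int a + of_int b * qomega m"
    using assms by (auto simp: ring_of_integers_imq_def)
  have "\<exists>N::int. (cmod x)\<^sup>2 = of_int N"
  proof (cases "m mod 4 = 3")
    case True
    define k where "k = m div 4"
    have m: "m = 4 * k + 3" using True unfolding k_def by presburger
    have "(cmod x)\<^sup>2 = (real_of_int a + real_of_int b / 2)\<^sup>2 + (real_of_int b * sqrt (real m) / 2)\<^sup>2"
      using True by (simp add: x qomega_def cmod_power2)
    also have "\<dots> = of_int (a\<^sup>2 + a * b + (int k + 1) * b\<^sup>2)"
      by (simp add: power_mult_distrib power_divide m) (simp add: power2_eq_square field_simps)
    finally show ?thesis by blast
  next
    case False
    have "(cmod x)\<^sup>2 = (real_of_int a)\<^sup>2 + (real_of_int b * sqrt (real m))\<^sup>2"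
      using False by (simp add: x qomega_def cmod_power2)
    also have "\<dots> = of_int (a\<^sup>2 + int m * b\<^sup>2)"
      by (simp add: power_mult_distrib)
    finally show ?thesis by blast
  qed
  then obtain N :: int where N: "(cmod x)\<^sup>2 = of_int N" by blast
  have "0 < (cmod x)\<^sup>2" using assms by simp
  then have "1 \<le> N" unfolding N by linarith
  then have "1\<^sup>2 \<le> (cmod x)\<^sup>2" unfolding N by simp
  then show ?thesis by (rule power2_le_imp_le) simp
qed

lemma is_order_of_int:
  assumes "is_order m R"
  shows "of_int n \<in> R"
proof -
  have 1: "1 \<in> R" and cl: "\<And>x y. x \<in> R \<Longrightarrow> y \<in> R \<Longrightarrow> x + y \<in> R \<and> - x \<in> R"
    using assms by (auto simp: is_order_def)
  have "0 \<in> R" using cl[OF 1] cl[of 1 "-1"] 1 by auto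
  then have nat: "of_nat k \<in> R" for k by (induction k) (use 1 cl in auto)
  show ?thesis by (cases n) (use nat cl in \<open>auto simp del: of_nat_Suc\<close>)
qed

text \<open>Rank 2 forces an element with non-zero \<open>qomega m\<close> coordinate. Removing its
  rational part, after doubling when \<open>m mod 4 = 3\<close>, leaves a purely imaginary
  element.\<close>

lemma is_order_imaginary:
  assumes R: "is_order m R" and m: "m > 0"
  obtains b :: int where "b > 0" "of_int b * (\<i> * complex_of_real (sqrt (real m))) \<in> R"
proof -
  have cl: "x + y \<in> R" "- x \<in> R" "x * y \<in> R" if "x \<in> R" "y \<in> R" for x y
    using R that by (auto simp: is_order_def)
  have sub: "R \<subseteq> ring_of_integers_imq m" using R by (auto simp: is_order_def)
  have "\<exists>u v. (\<forall>a b::int. of_int a * u + of_int b * v = 0 \<longrightarrow> a = 0 \<and> b = 0) \<and>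
      R = {of_int a * u + of_int b * v | a b::int. True}"
    using R unfolding is_order_def by (elim conjE)
  then obtain u v where uvR: "(\<forall>a b::int. of_int a * u + of_int b * v = 0 \<longrightarrow> a = 0 \<and> b = 0) \<and>
      R = {of_int a * u + of_int b * v | a b::int. True}"
    by (elim exE)
  have ind: "a = 0 \<and> b = 0" if "of_int a * u + of_int b * v = 0" for a b :: int
    using conjunct1[OF uvR, rule_format, OF that] .
  note Ruv = conjunct2[OF uvR]
  have u: "u \<in> R" unfolding Ruv by (rule CollectI, rule exI[of _ 1], rule exI[of _ 0]) simp
  have v: "v \<in> R" unfolding Ruv by (rule CollectI, rule exI[of _ 0], rule exI[of _ 1]) simp
  obtain a1 b1 where u': "u = of_int a1 + of_int b1 * qomega m"
    using u sub by (auto simp: ring_of_integers_imq_def)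
  obtain a2 b2 where v': "v = of_int a2 + of_int b2 * qomega m"
    using v sub by (auto simp: ring_of_integers_imq_def)
  \<comment> \<open>Two integers \<open>a1\<close>, \<open>a2\<close> satisfy the relation
    \<open>a2 * a1 - a1 * a2 = 0\<close>, against independence.\<close>
  have "b1 \<noteq> 0 \<or> b2 \<noteq> 0"
  proof (rule ccontr)
    assume "\<not> ?thesis"
    then have uv: "u = of_int a1" "v = of_int a2" by (auto simp: u' v')
    have "a2 = 0 \<and> - a1 = 0" by (rule ind) (simp add: uv)
    then show False using ind[of 1 0] uv by simp
  qed
  then obtain x a b where x: "x \<in> R" "x = of_int a + of_int b * qomega m" "b \<noteq> 0"
    using u v u' v' by blast
  have "\<exists>b::int. b \<noteq> 0 \<and> of_int b * (\<i> * complex_of_real (sqrt (real m))) \<in> R"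
  proof (cases "m mod 4 = 3")
    case True
    have "of_int b * (\<i> * complex_of_real (sqrt (real m))) = (x + x) + of_int (- 2 * a - b)"
      using True by (simp add: x qomega_def field_simps)
    then show ?thesis using x(3) cl(1)[OF cl(1)[OF x(1) x(1)] is_order_of_int[OF R]] by metis
  next
    case False
    have "of_int b * (\<i> * complex_of_real (sqrt (real m))) = x + of_int (- a)"
      using False by (simp add: x qomega_def)
    then show ?thesis using x(3) cl(1)[OF x(1) is_order_of_int[OF R]] by metis
  qed
  then obtain b' :: int where b': "b' \<noteq> 0" "of_int b' * (\<i> * complex_of_real (sqrt (real m))) \<in> R" by blast
  show ?thesis
  proof (cases "b' > 0")
    case False
    then show ?thesis using b' cl(2)[OF b'(2) b'(2)] that[of "- b'"] by simp
  qed (use b' that in blast)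
qed

text \<open>The order contains a rectangular lattice generated by 1 and \<open>\<i> * B\<close>, and
  both coordinates can be rounded down.\<close>

lemma is_order_covering_radius:
  assumes R: "is_order m R" and m: "m > 0"
  obtains C where "0 < C" "\<And>z. \<exists>n\<in>R. cmod (z - n) \<le> C"
proof -
  obtain b :: int where b: "b > 0" "of_int b * (\<i> * complex_of_real (sqrt (real m))) \<in> R"
    using is_order_imaginary[OF assms] by blast
  define B where "B = of_int b * sqrt (real m)"
  have B: "0 < B" using b m by (simp add: B_def)
  have iB: "\<i> * of_real B \<in> R" using b(2) by (simp add: B_def mult_ac)
  have "\<exists>n\<in>R. cmod (z - n) \<le> 1 + B" for z
  proof
    define n where "n = of_int \<lfloor>Re z\<rfloor> + of_int \<lfloor>Im z / B\<rfloor> * (\<i> * of_real B)"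
    show "n \<in> R" using R iB is_order_of_int[OF R] by (auto simp: n_def is_order_def)
    have re: "\<bar>Re (z - n)\<bar> \<le> 1" by (simp add: n_def) linarith
    have im: "Im (z - n) = (Im z / B - of_int \<lfloor>Im z / B\<rfloor>) * B"
      using B by (simp add: n_def left_diff_distrib)
    have "\<bar>Im z / B - of_int \<lfloor>Im z / B\<rfloor>\<bar> \<le> 1" by linarith
    then have "\<bar>Im (z - n)\<bar> \<le> 1 * B"
      unfolding im abs_mult using B by (intro mult_mono) auto
    then show "cmod (z - n) \<le> 1 + B" using re cmod_le[of "z - n"] by linarith
  qed
  then show ?thesis using that[of "1 + B"] B by simp
qed

lemma imag_quad_field_denominator:
  assumes R: "is_order m R" and m: "m > 0" and x: "x \<in> imag_quad_field m"
  obtains d where "d \<in> R" "d \<noteq> 0" "d * x \<in> R"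
proof -
  obtain b :: int where b: "b > 0" "of_int b * (\<i> * complex_of_real (sqrt (real m))) \<in> R" (is "_ * ?w \<in> _")
    using is_order_imaginary[OF R m] by blast
  have cl: "x + y \<in> R" "x * y \<in> R" if "x \<in> R" "y \<in> R" for x y
    using R that by (auto simp: is_order_def)
  note int = is_order_of_int[OF R]
  obtain s t :: rat where x: "x = of_real (of_rat s) + of_real (of_rat t) * \<i> * complex_of_real (sqrt (real m))"
    using x by (auto simp: imag_quad_field_def)
  obtain s1 s2 where s: "s = Fract s1 s2" "s2 > 0" by (cases s) auto
  obtain t1 t2 where t: "t = Fract t1 t2" "t2 > 0" by (cases t) auto
  have "of_int (b * s2 * t2) * x = of_int (b * s1 * t2) + of_int (s2 * t1) * (of_int b * ?w)"
    using s t b by (simp add: x of_rat_rat field_simps)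
  also have "\<dots> \<in> R" by (intro cl int b)
  finally show ?thesis using that[OF int[of "b * s2 * t2"]] s t b by simp
qed

section \<open>Separation and density of admissible fractions\<close>

text \<open>If \<open>a * p + b * q = 1\<close>, then \<open>q' = q * (a * p' + b * q')\<close>, so
  \<open>q\<close> divides \<open>q'\<close> in \<open>R\<close>. By symmetry the height depends on
  the fraction only, so that distinct points of the family have distinct first components.\<close>

lemma admissible_same_fraction_norm_le:
  assumes R: "is_order m R" and "(p, q) \<in> admissible_pairs R I" "(p', q') \<in> admissible_pairs R I"
    and I: "I \<subseteq> R" and "q \<noteq> 0" "q' \<noteq> 0" "p / q = p' / q'"
  shows "cmod q \<le> cmod q'"
proof -
  have cl: "x + y \<in> R" "x * y \<in> R" if "x \<in> R" "y \<in> R" for x y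
    using R that by (auto simp: is_order_def)
  have "1 \<in> gen_ideal2 R p q" using assms by (auto simp: admissible_pairs_def is_order_def)
  then obtain a b where ab: "a \<in> R" "b \<in> R" "1 = a * p + b * q" by (auto simp: gen_ideal2_def)
  have "q' = (a * p + b * q) * q'" using ab(3) by simp
  also have "\<dots> = a * (p * q') + b * q * q'" by (simp add: algebra_simps)
  also have "p * q' = p' * q" using assms by (simp add: field_simps)
  finally have q': "q' = q * (a * p' + b * q')" by (simp add: algebra_simps)
  have "a * p' + b * q' \<in> R" using assms ab by (intro cl) (auto simp: admissible_pairs_def)
  moreover have "a * p' + b * q' \<noteq> 0" using q' assms(6) by fastforce
  ultimately have "1 \<le> cmod (a * p' + b * q')"
    using R by (intro ring_of_integers_imq_norm_ge_1[of _ m]) (auto simp: is_order_def)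
  then have "cmod q * 1 \<le> cmod q * cmod (a * p' + b * q')" by (intro mult_left_mono) auto
  then show ?thesis by (subst q') (simp add: norm_mult)
qed

lemma admissible_dense:
  assumes R: "is_order m R" and m: "m > 0" and I: "is_ideal_of R I" "I \<noteq> {0}" and e: "0 < e"
  obtains p q where "(p, q) \<in> admissible_pairs R I" "q \<noteq> 0" "H < cmod q" "cmod (x - p / q) < e"
proof -
  have cl: "x + y \<in> R" "x * y \<in> R" "- x \<in> R" if "x \<in> R" "y \<in> R" for x y
    using R that by (auto simp: is_order_def)
  have oneR: "1 \<in> R" using R by (simp add: is_order_def)
  obtain Q where Q: "Q \<in> I" "Q \<noteq> 0" using I by (auto simp: is_ideal_of_def)
  have QR: "Q \<in> R" using Q I by (auto simp: is_ideal_of_def)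
  then have Q1: "1 \<le> cmod Q"
    using R Q by (intro ring_of_integers_imq_norm_ge_1[of _ m]) (auto simp: is_order_def)
  obtain C where C: "0 < C" "\<And>z. \<exists>n\<in>R. cmod (z - n) \<le> C"
    using is_order_covering_radius[OF R m] by blast
  \<comment> \<open>The pairs \<open>(1 + T n, T\<^sup>2)\<close> with \<open>T \<in> I\<close> are admissible since \<open>(1 - T n) (1 + T n) + n\<^sup>2 T\<^sup>2 = 1\<close>.\<close>
  obtain j :: nat where j: "max (max 1 H) (C / e) < real j" using reals_Archimedean2 by blast
  define T where "T = of_nat j * Q"
  have "of_nat j \<in> R" using is_order_of_int[OF R, of "int j"] by simp
  then have T: "T \<in> I" "T \<in> R" using Q QR I cl by (auto simp: T_def is_ideal_of_def)
  have jT: "real j \<le> cmod T" using mult_left_mono[OF Q1, of "real j"] by (simp add: T_def norm_mult)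
  have T0: "T \<noteq> 0" using jT j by auto
  \<comment> \<open>With this \<open>n\<close> the error of the fraction is the rounding error
    divided by \<open>T\<close>, hence at most \<open>C / cmod T\<close>.\<close>
  obtain n where n: "n \<in> R" "cmod ((x * T\<^sup>2 - 1) / T - n) \<le> C" using C(2) by blast
  show ?thesis
  proof
    have sub: "gen_ideal2 R (1 + T * n) (T\<^sup>2) \<subseteq> R"
      using T n oneR by (auto simp: gen_ideal2_def power2_eq_square intro!: cl)
    have "R \<subseteq> gen_ideal2 R (1 + T * n) (T\<^sup>2)"
    proof
      fix y assume y: "y \<in> R"
      have "y = (y * (1 + - (T * n))) * (1 + T * n) + (y * (n * n)) * T\<^sup>2"
        by (simp add: algebra_simps power2_eq_square)
      moreover have "y * (1 + - (T * n)) \<in> R" by (intro cl(1,2) cl(3)[OF _ oneR] y T n oneR)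
      moreover have "y * (n * n) \<in> R" by (intro cl y n)
      ultimately show "y \<in> gen_ideal2 R (1 + T * n) (T\<^sup>2)" unfolding gen_ideal2_def by blast
    qed
    with sub show "(1 + T * n, T\<^sup>2) \<in> admissible_pairs R I"
      using T n oneR I by (auto simp: admissible_pairs_def power2_eq_square is_ideal_of_def intro!: cl)
    show "T\<^sup>2 \<noteq> 0" using T0 by simp
    have "cmod T * 1 \<le> cmod T * cmod T" using jT j by (intro mult_left_mono) auto
    then show "H < cmod (T\<^sup>2)" using jT j by (simp add: norm_mult power2_eq_square)
    have "x - (1 + T * n) / T\<^sup>2 = ((x * T\<^sup>2 - 1) / T - n) / T"
      using T0 by (simp add: field_simps power2_eq_square)
    then have "cmod (x - (1 + T * n) / T\<^sup>2) \<le> C / cmod T"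
      using n T0 by (simp add: norm_divide divide_right_mono)
    also have "C / cmod T \<le> C / real j" using jT j C by (intro divide_left_mono mult_pos_pos) auto
    also have "\<dots> < e" using j e by (simp add: field_simps)
    finally show "cmod (x - (1 + T * n) / T\<^sup>2) < e" .
  qed
qed

text \<open>The difference of two fractions has numerator \<open>p * q' - p' * q\<close>, a non-zero
  element of \<open>R\<close> and so of modulus at least 1.\<close>

lemma separated_points_admissible:
  assumes R: "is_order m R" and m: "m > 0" and I: "is_ideal_of R I" "I \<noteq> {0}"
  shows "separated_points {(p / q, cmod q) | p q. (p, q) \<in> admissible_pairs R I \<and> q \<noteq> 0}"
proof -
  have cl: "x + y \<in> R" "x * y \<in> R" "- x \<in> R" if "x \<in> R" "y \<in> R" for x y
    using R that by (auto simp: is_order_def)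
  have IR: "I \<subseteq> R" using I by (simp add: is_ideal_of_def)
  have ge1: "1 \<le> cmod y" if "y \<in> R" "y \<noteq> 0" for y
    using R that by (intro ring_of_integers_imq_norm_ge_1[of _ m]) (auto simp: is_order_def)
  show ?thesis
  proof (unfold_locales, goal_cases)
    case (1 z h)
    then show ?case using ge1 IR by (auto simp: admissible_pairs_def)
  next
    case (2 z h z' h')
    then obtain p q p' q' where zh: "z = p / q" "h = cmod q" "z' = p' / q'" "h' = cmod q'"
      and adm: "(p, q) \<in> admissible_pairs R I" "(p', q') \<in> admissible_pairs R I" and q: "q \<noteq> 0" "q' \<noteq> 0"
      by auto
    have mem: "p \<in> R" "q \<in> R" "p' \<in> R" "q' \<in> R" using adm IR by (auto simp: admissible_pairs_def)
    have ne: "p / q \<noteq> p' / q'"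
    proof
      assume eq: "p / q = p' / q'"
      then have "cmod q = cmod q'"
        using admissible_same_fraction_norm_le[OF R adm IR q eq]
          admissible_same_fraction_norm_le[OF R adm(2,1) IR q(2,1) eq[symmetric]] by simp
      then show False using 2 zh eq by simp
    qed
    have eq: "p / q - p' / q' = (p * q' + - (p' * q)) / (q * q')"
      using q by (simp add: field_simps)
    have "p * q' + - (p' * q) \<in> R" using mem by (intro cl) auto
    moreover have "p * q' + - (p' * q) \<noteq> 0" using ne eq by auto
    ultimately have "1 / (cmod q * cmod q') \<le> cmod (p * q' + - (p' * q)) / (cmod q * cmod q')"
      using ge1 by (intro divide_right_mono) auto
    then show ?case unfolding zh dist_norm eq by (simp add: norm_divide norm_mult)
  next
    case (3 e H x)
    then obtain p q where "(p, q) \<in> admissible_pairs R I" "q \<noteq> 0" "H < cmod q" "cmod (x - p / q) < e"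
      using admissible_dense[OF R m I] by blast
    then show ?case by (intro bexI[of _ "(p / q, cmod q)"]) (auto simp: dist_norm)
  qed
qed

section \<open>Approximation constants and the spectrum\<close>

lemma lagrange_c_eqI:
  assumes lower: "\<And>p q. (p, q) \<in> admissible_pairs R I \<Longrightarrow> q \<noteq> 0 \<Longrightarrow> r \<le> (cmod q)\<^sup>2 * cmod (x - p / q)"
    and upper: "\<And>e H. 0 < e \<Longrightarrow> \<exists>(p, q)\<in>admissible_pairs R I. H < cmod q \<and> (cmod q)\<^sup>2 * cmod (x - p / q) < r + e"
  shows "lagrange_c R I x = ereal r"
proof -
  define F where "F = inf (filtercomap (\<lambda>(p, q). cmod q) at_top) (principal (admissible_pairs R I))"
  define X where "X = (\<lambda>(p, q). ereal ((cmod q)\<^sup>2 * cmod (x - p / q)))"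
  have F: "eventually P F \<longleftrightarrow> (\<exists>H. \<forall>(p, q)\<in>admissible_pairs R I. H \<le> cmod q \<longrightarrow> P (p, q))" for P
    unfolding F_def eventually_inf_principal eventually_filtercomap_at_top_linorder by fastforce
  have "ereal r \<le> Liminf F X"
  proof (rule Liminf_bounded)
    show "\<forall>\<^sub>F y in F. ereal r \<le> X y"
      \<comment> \<open>The threshold 1 excludes \<open>q = 0\<close>, where \<open>lower\<close>
        says nothing.\<close>
      unfolding F using lower by (intro exI[of _ 1]) (force simp: X_def)
  qed
  moreover have "Liminf F X \<le> ereal r"
  proof (rule ccontr)
    assume "\<not> ?thesis"
    then obtain y where y: "ereal r < ereal y" "ereal y < Liminf F X"
      using ereal_dense2[of "ereal r" "Liminf F X"] by (auto simp: not_le)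
    then have "\<forall>\<^sub>F u in F. ereal y < X u" using le_Liminf_iff[of "Liminf F X" F X] by auto
    then obtain H where H: "\<And>p q. (p, q) \<in> admissible_pairs R I \<Longrightarrow> H \<le> cmod q \<Longrightarrow> ereal y < X (p, q)"
      unfolding F by auto
    obtain p q where "(p, q) \<in> admissible_pairs R I" "H < cmod q" "(cmod q)\<^sup>2 * cmod (x - p / q) < r + (y - r)"
      using upper[of "y - r" H] y by auto
    then show False using H[of p q] by (auto simp: X_def)
  qed
  ultimately show ?thesis by (simp add: lagrange_c_def F_def X_def)
qed

theorem theorem1p7:
  fixes m :: nat and R I :: "complex set"
  assumes "m > 0" and "squarefree m"
    and "is_order m R"
    and "is_ideal_of R I" and "I \<noteq> {0}"
  shows "{0..0.033} \<subseteq> lagrange_spectrum m R I"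
proof
  fix r :: real assume "r \<in> {0..0.033}"
  then have r: "0 \<le> r" "r \<le> 33/1000" by auto
  note R = assms(3)
  have cl: "x + y \<in> R" "x * y \<in> R" "- x \<in> R" if "x \<in> R" "y \<in> R" for x y
    using R that by (auto simp: is_order_def)
  have oneR: "1 \<in> R" using R by (simp add: is_order_def)
  interpret separated_points "{(p / q, cmod q) | p q. (p, q) \<in> admissible_pairs R I \<and> q \<noteq> 0}"
    using separated_points_admissible[OF R assms(1,4,5)] .
  obtain x where lower: "\<And>z h. (z, h) \<in> {(p / q, cmod q) | p q. (p, q) \<in> admissible_pairs R I \<and> q \<noteq> 0} \<Longrightarrow>
        r \<le> h\<^sup>2 * dist x z"
    and upper: "\<And>e H. 0 < e \<Longrightarrow> \<exists>(z, h)\<in>{(p / q, cmod q) | p q. (p, q) \<in> admissible_pairs R I \<and> q \<noteq> 0}.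
        H < h \<and> x \<noteq> z \<and> h\<^sup>2 * dist x z < r + e"
    using exists_approximation_constant[OF r] by blast
  have upper': "\<exists>(p, q)\<in>admissible_pairs R I. q \<noteq> 0 \<and> H < cmod q \<and> x \<noteq> p / q \<and> (cmod q)\<^sup>2 * cmod (x - p / q) < r + e"
    if "0 < e" for e H
    using upper[OF that, of H] by (auto simp: dist_norm)
  have "lagrange_c R I x = ereal r"
  proof (rule lagrange_c_eqI)
    show "r \<le> (cmod q)\<^sup>2 * cmod (x - p / q)" if "(p, q) \<in> admissible_pairs R I" "q \<noteq> 0" for p q
      using lower[of "p / q" "cmod q"] that by (auto simp: dist_norm)
  qed (use upper' in fast)
  \<comment> \<open>For \<open>x\<close> in the field with denominator \<open>d\<close>, the number
    \<open>d * (q * x - p)\<close> would be a non-zero element of \<open>R\<close>. Its modulus is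
    at most \<open>cmod d * (r + 1) / cmod q\<close>, which is below 1 for a good approximation with
    large \<open>q\<close>.\<close>
  moreover have "x \<notin> imag_quad_field m"
  proof
    assume "x \<in> imag_quad_field m"
    then obtain d where d: "d \<in> R" "d \<noteq> 0" "d * x \<in> R"
      using imag_quad_field_denominator[OF R assms(1)] by blast
    obtain p q where pq: "(p, q) \<in> admissible_pairs R I" "q \<noteq> 0" "(r + 1) * cmod d < cmod q"
      "x \<noteq> p / q" "(cmod q)\<^sup>2 * cmod (x - p / q) < r + 1"
      using upper'[of 1 "(r + 1) * cmod d"] by auto
    have mem: "p \<in> R" "q \<in> R" using pq assms(4) by (auto simp: admissible_pairs_def is_ideal_of_def)
    define y where "y = q * (d * x) + - (d * p)"
    have y: "y = d * q * (x - p / q)" using pq by (simp add: y_def algebra_simps)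
    have "y \<in> R" unfolding y_def by (intro cl(1) cl(2)[OF mem(2) d(3)] cl(3)[OF _ oneR] cl(2)[OF d(1) mem(1)])
    moreover have "y \<noteq> 0" using y d pq by simp
    ultimately have "1 \<le> cmod y"
      using R by (intro ring_of_integers_imq_norm_ge_1[of _ m]) (auto simp: is_order_def)
    then have "cmod q * 1 \<le> cmod q * cmod y" by (intro mult_left_mono) auto
    also have "\<dots> = cmod d * ((cmod q)\<^sup>2 * cmod (x - p / q))"
      by (simp add: y norm_mult power2_eq_square)
    also have "\<dots> \<le> cmod d * (r + 1)" using pq by (intro mult_left_mono) auto
    finally show False using pq(3) by (simp add: mult.commute)
  qed
  ultimately show "r \<in> lagrange_spectrum m R I" by (auto simp: lagrange_spectrum_def)
qed

end
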